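(* Let $\Omega_\diamond:\mathbb{R}^m\times\mathbb{R}_{\ge 0}\rightrightarrows\mathbb{U}$ be a multi-valued map that induces asymptotic constraints, and suppose that the function $V^\diamond$ is finite (i.e. real-valued everywhere on $\mathbb{R}_{\ge 0}\times\mathbb{R}^m$). Then: (1) $V^\diamond$ enjoys the Dynamic Programming Principle (DPP); (2) a control $u^*\in\mathbb{U}$ is optimal in view of $V^\diamond$ if $u^*\in\Omega_\diamond(b_*,0)$ and $$\liminf_{T\to+\infty}J(0,b_*;u^*,T)=V^\diamond(0,b_* ).$$
   Context: Setting: $P$ is a complete separable metric space; $\mathbb{U}$ is the set of all Lebesgue measurable $u:\mathbb{R}_{\ge 0}\to P$ that are bounded on every compact time interval. The functions $f:\mathbb{R}_{\ge 0}\times\mathbb{R}^m\times P\to\mathbb{R}^m$ and $f_0:\mathbb{R}_{\ge 0}\times\mathbb{R}^m\times P\to\mathbb{R}$ are continuous and locally Lipschitz continuous in $x$, and $f$ satisfies the sublinear growth condition (at most linear growth in $\|x\|$), so that for each $(b,t)\in\mathbb{R}^m\times\mathbb{R}_{\ge 0}$ and $u\in\mathbb{U}$ the equation $\dot x=f(t,x,u(t))$ with $x(t)=b$ has a unique solution, extendable to all of $\mathbb{R}_{\ge 0}$, denoted $x_{b,t,u}$. The initial state $b_*\in\mathbb{R}^m$ is fixed; for a control $u^*\in\mathbb U$, $x^*=x_{b_*,0,u^*}$. Cost: $J(\theta,y;u,T)=\int_\theta^T f_0(s,x_{y,\theta,u}(s),u(s))\,ds$. Concatenation: for $u',u''\in\mathbb{U}$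 and $T\ge 0$, $(u'\diamond_T u'')(t)=u'(t)$ if $t<T$ and $(u'\diamond_T u'')(t)=u''(t)$ if $t\ge T$. A multi-valued map $\Omega_\diamond:\mathbb{R}^m\times\mathbb{R}_{\ge 0}\rightrightarrows\mathbb{U}$ induces asymptotic constraints iff for all $(b,t)\in\mathbb{R}^m\times\mathbb{R}_{\ge 0}$ and all $T>t$, $$\Omega_\diamond(b,t)=\{u\diamond_T u_1 : u\in\mathbb{U},\ u_1\in\Omega_\diamond(x_{b,t,u}(T),T)\}.$$ The function $V^\diamond:\mathbb{R}_{\ge 0}\times\mathbb{R}^m\to\mathbb{R}\cup\{-\infty,+\infty\}$ is defined by $V^\diamond(t,b)=+\infty$ if $\Omega_\diamond(b,t)=\varnothing$, and $V^\diamond(t,b)=\inf_{u\in\Omega_\diamond(b,t)}\liminf_{T\to+\infty}J(t,b;u,T)$ otherwise. DPP: a function $\mathbb{V}:\mathbb{R}_{\ge 0}\times\mathbb{R}^m\to\mathbb{R}\cup\{\pm\infty\}$ enjoys the Dynamic Programming Principle iff $\mathbb{V}(t,b)=\inf_{u\in\mathbb{U}}\big[\int_t^\tau f_0(s,x_{b,t,u}(s),u(s))\,ds+\mathbb{V}(\tau,x_{b,t,u}(\tau))\big]$ for all $b\in\mathbb{R}^m$ and $[t,\tau]\subset\mathbb{R}_{\ge 0}$. For a function $\mathbb{V}$ enjoying DPP, $u^*$ is optimal in view of $\mathbb{V}$ iff $\mathbb{V}(T,x^*(T))+J(0,x^*(0);u^*,T)=\mathbb{V}(0,x^*(0))$ for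 all $T\ge 0$. *)

theory Defs
  imports "HOL-Analysis.Analysis"
begin

text \<open>
  Functions on \<open>[0,\<infinity>)\<close> are represented as functions on \<open>real\<close> that are \<open>extensional\<close> on
  \<open>{0..}\<close>, so that equality of such functions is equality on \<open>[0,\<infinity>)\<close>.
  A complete separable metric space is a type of class \<open>polish_space\<close>.
\<close>

definition controls :: "(real \<Rightarrow> 'p::polish_space) set" where
  "controls = {u \<in> extensional {0..}.
     u \<in> measurable (lebesgue_on {0..}) borel \<and>
     (\<forall>a b. 0 \<le> a \<longrightarrow> bounded (u ` {a..b}))}"

text \<open>
  Growth at most linear in the state. The coefficient is only required to be locally integrable
  in time along each control; a constant coefficient, or one that is bounded for bounded time and
  bounded control values, is a special case.
\<close>

definition sublinear_growth ::
  "(real \<Rightarrow> 'x::real_normed_vector \<Rightarrow> 'p::polish_space \<Rightarrow> 'x) \<Rightarrow> bool" where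
  "sublinear_growth f \<longleftrightarrow>
     (\<forall>u \<in> controls. \<exists>M :: real \<Rightarrow> real.
        (\<forall>T\<ge>0. set_integrable lebesgue {0..T} M) \<and>
        (\<forall>t\<ge>0. \<forall>x. norm (f t x (u t)) \<le> M t * (1 + norm x)))"

definition abs_continuous_on_Icc :: "real \<Rightarrow> real \<Rightarrow> (real \<Rightarrow> 'x::real_normed_vector) \<Rightarrow> bool" where
  "abs_continuous_on_Icc a b x \<longleftrightarrow>
     (\<forall>\<epsilon>>0. \<exists>\<delta>>0. \<forall>(n::nat) l r.
        (\<forall>i<n. a \<le> l i \<and> l i \<le> r i \<and> r i \<le> b) \<and>
        disjoint_family_on (\<lambda>i. {l i<..<r i}) {..<n} \<and>
        (\<Sum>i<n. r i - l i) < \<delta>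
        \<longrightarrow> (\<Sum>i<n. norm (x (r i) - x (l i))) < \<epsilon>)"

text \<open>
  Since controls are merely measurable, solutions are understood in the sense of Caratheodory.
  They live on all of \<open>[0,\<infinity>)\<close>, also to the left of the time \<open>t\<close> at which the state \<open>b\<close> is
  prescribed.
\<close>

definition is_solution ::
  "(real \<Rightarrow> 'x::real_normed_vector \<Rightarrow> 'p \<Rightarrow> 'x) \<Rightarrow> 'x \<Rightarrow> real \<Rightarrow> (real \<Rightarrow> 'p) \<Rightarrow> (real \<Rightarrow> 'x) \<Rightarrow> bool" where
  "is_solution f b t u x \<longleftrightarrow>
     x \<in> extensional {0..} \<and>
     (\<forall>T\<ge>0. abs_continuous_on_Icc 0 T x) \<and>
     (AE s in lebesgue. 0 \<le> s \<longrightarrow>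
        (x has_vector_derivative f s (x s) (u s)) (at s within {0..})) \<and>
     x t = b"

text \<open>
  The standing fact that the equation has unique global solutions. It is automatic from local
  Lipschitz continuity and sublinear growth if bounded subsets of the control space are relatively
  compact, but not in general: for a discrete bounded countable control space the Lipschitz
  constant need not be locally integrable along a control.
\<close>

definition well_posed ::
  "(real \<Rightarrow> 'x::real_normed_vector \<Rightarrow> 'p::polish_space \<Rightarrow> 'x) \<Rightarrow> bool" where
  "well_posed f \<longleftrightarrow> (\<forall>b. \<forall>t\<ge>0. \<forall>u \<in> controls. \<exists>!x. is_solution f b t u x)"

text \<open>The trajectory \<open>x\<^sub>b\<^sub>,\<^sub>t\<^sub>,\<^sub>u\<close>.\<close>

definition traj ::
  "(real \<Rightarrow> 'x::real_normed_vector \<Rightarrow> 'p \<Rightarrow> 'x) \<Rightarrow> 'x \<Rightarrow> real \<Rightarrow> (real \<Rightarrow> 'p) \<Rightarrow> real \<Rightarrow> 'x" where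
  "traj f b t u = (THE x. is_solution f b t u x)"

text \<open>
  The running cost must be integrable along trajectories for the cost to be defined. This does not
  follow from continuity of \<open>f0\<close>: bounded subsets of the control space need not be relatively
  compact, so \<open>f0\<close> may be unbounded along a bounded control.
\<close>

definition cost_defined ::
  "(real \<Rightarrow> 'x::real_normed_vector \<Rightarrow> 'p::polish_space \<Rightarrow> 'x) \<Rightarrow> (real \<Rightarrow> 'x \<Rightarrow> 'p \<Rightarrow> real) \<Rightarrow> bool" where
  "cost_defined f f0 \<longleftrightarrow>
     (\<forall>b. \<forall>t\<ge>0. \<forall>u \<in> controls. \<forall>T\<ge>t.
        set_integrable lebesgue {t..T} (\<lambda>s. f0 s (traj f b t u s) (u s)))"

text \<open>Only meaningful for \<open>\<theta> \<le> T\<close>.\<close>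

definition cost ::
  "(real \<Rightarrow> 'x::real_normed_vector \<Rightarrow> 'p \<Rightarrow> 'x) \<Rightarrow> (real \<Rightarrow> 'x \<Rightarrow> 'p \<Rightarrow> real)
     \<Rightarrow> real \<Rightarrow> 'x \<Rightarrow> (real \<Rightarrow> 'p) \<Rightarrow> real \<Rightarrow> real" where
  "cost f f0 \<theta> y u T = (LINT s:{\<theta>..T}|lebesgue. f0 s (traj f y \<theta> u s) (u s))"

definition concat_control :: "real \<Rightarrow> (real \<Rightarrow> 'p) \<Rightarrow> (real \<Rightarrow> 'p) \<Rightarrow> real \<Rightarrow> 'p" where
  "concat_control T u' u'' = (\<lambda>t. if t < T then u' t else u'' t)"

definition induces_asymptotic_constraints ::
  "(real \<Rightarrow> 'x::real_normed_vector \<Rightarrow> 'p::polish_space \<Rightarrow> 'x)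
     \<Rightarrow> ('x \<Rightarrow> real \<Rightarrow> (real \<Rightarrow> 'p) set) \<Rightarrow> bool" where
  "induces_asymptotic_constraints f \<Omega> \<longleftrightarrow>
     (\<forall>b. \<forall>t\<ge>0. \<forall>T>t.
        \<Omega> b t = {concat_control T u u1 | u u1. u \<in> controls \<and> u1 \<in> \<Omega> (traj f b t u T) T})"

definition value_fun ::
  "(real \<Rightarrow> 'x::real_normed_vector \<Rightarrow> 'p \<Rightarrow> 'x) \<Rightarrow> (real \<Rightarrow> 'x \<Rightarrow> 'p \<Rightarrow> real)
     \<Rightarrow> ('x \<Rightarrow> real \<Rightarrow> (real \<Rightarrow> 'p) set) \<Rightarrow> real \<Rightarrow> 'x \<Rightarrow> ereal" where
  "value_fun f f0 \<Omega> t b =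
     (if \<Omega> b t = {} then \<infinity>
      else (INF u\<in>\<Omega> b t. Liminf at_top (\<lambda>T. ereal (cost f f0 t b u T))))"

definition enjoys_DPP ::
  "(real \<Rightarrow> 'x::real_normed_vector \<Rightarrow> 'p::polish_space \<Rightarrow> 'x) \<Rightarrow> (real \<Rightarrow> 'x \<Rightarrow> 'p \<Rightarrow> real)
     \<Rightarrow> (real \<Rightarrow> 'x \<Rightarrow> ereal) \<Rightarrow> bool" where
  "enjoys_DPP f f0 V \<longleftrightarrow>
     (\<forall>b t \<tau>. 0 \<le> t \<and> t \<le> \<tau> \<longrightarrow>
        V t b = (INF u\<in>controls.
          ereal (LINT s:{t..\<tau>}|lebesgue. f0 s (traj f b t u s) (u s)) + V \<tau> (traj f b t u \<tau>)))"

text \<open>Optimality of \<open>u\<close> for the initial state \<open>b\<close>; used only for \<open>V\<close> that enjoys the DPP.\<close>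

definition optimal_in_view ::
  "(real \<Rightarrow> 'x::real_normed_vector \<Rightarrow> 'p \<Rightarrow> 'x) \<Rightarrow> (real \<Rightarrow> 'x \<Rightarrow> 'p \<Rightarrow> real)
     \<Rightarrow> (real \<Rightarrow> 'x \<Rightarrow> ereal) \<Rightarrow> 'x \<Rightarrow> (real \<Rightarrow> 'p) \<Rightarrow> bool" where
  "optimal_in_view f f0 V b u \<longleftrightarrow>
     (let x = traj f b 0 u in
      \<forall>T\<ge>0. V T (x T) + ereal (cost f f0 0 (x 0) u T) = V 0 (x 0))"

end

theory Submission
  imports Defs
begin

text \<open>
  Everything rests on one splitting of the cost. A control in \<open>\<Omega> b t\<close> is a concatenation, at any
  later time \<open>\<tau>\<close>, of an arbitrary control \<open>u\<close> with an admissible control \<open>v\<close> for the state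
  \<open>c = traj f b t u \<tau>\<close> reached by \<open>u\<close>. By uniqueness of solutions, the trajectory of the
  concatenation is that of \<open>u\<close> up to time \<open>\<tau>\<close> and that of \<open>v\<close> started in \<open>c\<close> afterwards
  (\<open>traj_concat\<close>). Hence its cost is a number depending only on \<open>u\<close> plus the cost of \<open>v\<close>
  (\<open>cost_concat\<close>), and adding a real number commutes with lower limits and infima.

  The set \<open>\<Omega> b t\<close> ranges over all pairs \<open>(u, v)\<close>, so an infimum over it is an infimum over \<open>u\<close> of
  infima over \<open>v\<close>; the inner one is the value at time \<open>\<tau>\<close>. This is the dynamic programming
  principle (\<open>value_fun_DPP\<close>). For a control of \<open>\<Omega> b 0\<close> attaining the infimum, the tail \<open>v\<close> shows
  that its cost up to \<open>T\<close> plus the value at \<open>T\<close> is at most the value at \<open>0\<close>, and the dynamic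
  programming principle gives the opposite inequality.
\<close>

section \<open>Gluing solutions\<close>

text \<open>
  Each interval is cut at \<open>T\<close>: its left part carries the increment of \<open>x\<close> and its right part that
  of \<open>y\<close>, so \<open>\<epsilon> / 2\<close> is available for each.
\<close>

lemma abs_continuous_on_Icc_glue:
  fixes x y :: "real \<Rightarrow> 'x::real_normed_vector"
  assumes x: "abs_continuous_on_Icc a b x" and y: "abs_continuous_on_Icc a b y"
    and T: "a \<le> T" "T \<le> b" and eq: "x T = y T"
  shows "abs_continuous_on_Icc a b (\<lambda>s. if s \<le> T then x s else y s)"
  unfolding abs_continuous_on_Icc_def
proof (intro allI impI)
  fix e :: real assume "e > 0"
  then have e2: "e / 2 > 0" by simp
  obtain d1 where d1: "d1 > 0" "\<And>(n::nat) l r.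
        (\<forall>i<n. a \<le> l i \<and> l i \<le> r i \<and> r i \<le> b) \<Longrightarrow>
        disjoint_family_on (\<lambda>i. {l i<..<r i}) {..<n} \<Longrightarrow>
        (\<Sum>i<n. r i - l i) < d1 \<Longrightarrow> (\<Sum>i<n. norm (x (r i) - x (l i))) < e / 2"
    using x e2 unfolding abs_continuous_on_Icc_def by meson
  obtain d2 where d2: "d2 > 0" "\<And>(n::nat) l r.
        (\<forall>i<n. a \<le> l i \<and> l i \<le> r i \<and> r i \<le> b) \<Longrightarrow>
        disjoint_family_on (\<lambda>i. {l i<..<r i}) {..<n} \<Longrightarrow>
        (\<Sum>i<n. r i - l i) < d2 \<Longrightarrow> (\<Sum>i<n. norm (y (r i) - y (l i))) < e / 2"
    using y e2 unfolding abs_continuous_on_Icc_def by meson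
  let ?z = "\<lambda>s. if s \<le> T then x s else y s"
  show "\<exists>\<delta>>0. \<forall>(n::nat) l r.
        (\<forall>i<n. a \<le> l i \<and> l i \<le> r i \<and> r i \<le> b) \<and>
        disjoint_family_on (\<lambda>i. {l i<..<r i}) {..<n} \<and>
        (\<Sum>i<n. r i - l i) < \<delta>
        \<longrightarrow> (\<Sum>i<n. norm (?z (r i) - ?z (l i))) < e"
  proof (intro exI[of _ "min d1 d2"] conjI allI impI)
    show "min d1 d2 > 0" using d1(1) d2(1) by simp
    fix n :: nat and l r :: "nat \<Rightarrow> real"
    assume A: "(\<forall>i<n. a \<le> l i \<and> l i \<le> r i \<and> r i \<le> b) \<and>
        disjoint_family_on (\<lambda>i. {l i<..<r i}) {..<n} \<and> (\<Sum>i<n. r i - l i) < min d1 d2"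
    then have lr: "\<And>i. i < n \<Longrightarrow> a \<le> l i \<and> l i \<le> r i \<and> r i \<le> b"
      and dis: "disjoint_family_on (\<lambda>i. {l i<..<r i}) {..<n}"
      and sm: "(\<Sum>i<n. r i - l i) < min d1 d2" by auto
    have "(\<Sum>i<n. min (r i) T - min (l i) T) \<le> (\<Sum>i<n. r i - l i)"
      using lr by (intro sum_mono) (fastforce simp: min_def)
    moreover have "disjoint_family_on (\<lambda>i. {min (l i) T<..<min (r i) T}) {..<n}"
      using dis by (rule disjoint_family_on_bisimulation) (auto simp: disjoint_iff)
    moreover have "\<forall>i<n. a \<le> min (l i) T \<and> min (l i) T \<le> min (r i) T \<and> min (r i) T \<le> b"
      using lr T by (force simp: min_def)
    ultimately have L: "(\<Sum>i<n. norm (x (min (r i) T) - x (min (l i) T))) < e / 2"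
      using sm by (intro d1(2)) auto
    have "(\<Sum>i<n. max (r i) T - max (l i) T) \<le> (\<Sum>i<n. r i - l i)"
      using lr by (intro sum_mono) (fastforce simp: max_def)
    moreover have "disjoint_family_on (\<lambda>i. {max (l i) T<..<max (r i) T}) {..<n}"
      using dis by (rule disjoint_family_on_bisimulation) (auto simp: disjoint_iff)
    moreover have "\<forall>i<n. a \<le> max (l i) T \<and> max (l i) T \<le> max (r i) T \<and> max (r i) T \<le> b"
      using lr T by (force simp: max_def)
    ultimately have R: "(\<Sum>i<n. norm (y (max (r i) T) - y (max (l i) T))) < e / 2"
      using sm by (intro d2(2)) auto
    \<comment> \<open>At every point one of the two terms equals the common value at \<open>T\<close>; as a sum, the glued
      function needs no case distinction on the position of the interval.\<close>
    have split: "?z s = x (min s T) + y (max s T) - y T" for s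
      using eq by (auto simp: min_def max_def)
    have "norm (?z (r i) - ?z (l i)) \<le>
        norm (x (min (r i) T) - x (min (l i) T)) + norm (y (max (r i) T) - y (max (l i) T))" for i
    proof -
      have "?z (r i) - ?z (l i) =
          (x (min (r i) T) - x (min (l i) T)) + (y (max (r i) T) - y (max (l i) T))"
        unfolding split by (simp add: algebra_simps)
      then show ?thesis by (simp only: norm_triangle_ineq)
    qed
    then have "(\<Sum>i<n. norm (?z (r i) - ?z (l i))) \<le>
        (\<Sum>i<n. norm (x (min (r i) T) - x (min (l i) T)) + norm (y (max (r i) T) - y (max (l i) T)))"
      by (rule sum_mono)
    also have "\<dots> < e" using L R by (simp add: sum.distrib)
    finally show "(\<Sum>i<n. norm (?z (r i) - ?z (l i))) < e" .
  qed
qed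

lemma abs_continuous_on_Icc_subset:
  assumes "abs_continuous_on_Icc a b x" "a \<le> c" "d \<le> b"
  shows "abs_continuous_on_Icc c d x"
  unfolding abs_continuous_on_Icc_def
proof (intro allI impI)
  fix e :: real assume "e > 0"
  then obtain k where k: "k > 0" "\<And>(n::nat) l r.
        (\<forall>i<n. a \<le> l i \<and> l i \<le> r i \<and> r i \<le> b) \<Longrightarrow>
        disjoint_family_on (\<lambda>i. {l i<..<r i}) {..<n} \<Longrightarrow>
        (\<Sum>i<n. r i - l i) < k \<Longrightarrow> (\<Sum>i<n. norm (x (r i) - x (l i))) < e"
    using assms(1) unfolding abs_continuous_on_Icc_def by meson
  show "\<exists>\<delta>>0. \<forall>(n::nat) l r.
        (\<forall>i<n. c \<le> l i \<and> l i \<le> r i \<and> r i \<le> d) \<and>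
        disjoint_family_on (\<lambda>i. {l i<..<r i}) {..<n} \<and>
        (\<Sum>i<n. r i - l i) < \<delta>
        \<longrightarrow> (\<Sum>i<n. norm (x (r i) - x (l i))) < e"
  proof (intro exI[of _ k] conjI allI impI k(1), elim conjE)
    fix n :: nat and l r :: "nat \<Rightarrow> real"
    assume A: "\<forall>i<n. c \<le> l i \<and> l i \<le> r i \<and> r i \<le> d"
      and B: "disjoint_family_on (\<lambda>i. {l i<..<r i}) {..<n}" "(\<Sum>i<n. r i - l i) < k"
    have "\<forall>i<n. a \<le> l i \<and> l i \<le> r i \<and> r i \<le> b"
      using A assms(2,3) by fastforce
    then show "(\<Sum>i<n. norm (x (r i) - x (l i))) < e"
      using B by (rule k(2))
  qed
qed

lemma AE_lebesgue_neq: "AE s in lebesgue. s \<noteq> (c::'a::euclidean_space)"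
  using AE_lborel_singleton by (rule AE_completion)

text \<open>
  Before time \<open>T\<close> the control of the concatenation is \<open>u\<close>, even to the left of \<open>t\<close>, so the glued
  function solves the equation on the whole half-line. The single time \<open>T\<close>, where a derivative may
  fail to exist, is a null set.
\<close>

lemma is_solution_concat:
  assumes x: "is_solution f b t u x" and y: "is_solution f (x T) T v y"
    and T: "0 \<le> T" "t \<le> T"
  shows "is_solution f b t (concat_control T u v) (\<lambda>s. if s \<le> T then x s else y s)"
    (is "is_solution _ _ _ ?w ?z")
  unfolding is_solution_def
proof (intro conjI allI impI)
  have yT: "x T = y T" using y by (simp add: is_solution_def)
  show "?z \<in> extensional {0..}"
    using x y T by (auto simp: is_solution_def extensional_def)
  show "?z t = b" using x T by (simp add: is_solution_def)
  show "abs_continuous_on_Icc 0 S ?z" if "0 \<le> S" for S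
  proof (rule abs_continuous_on_Icc_subset)
    show "abs_continuous_on_Icc 0 (max S T) ?z"
      using x y T yT by (intro abs_continuous_on_Icc_glue) (auto simp: is_solution_def max_def)
  qed simp_all
  have "AE s in lebesgue. 0 \<le> s \<longrightarrow> (x has_vector_derivative f s (x s) (u s)) (at s within {0..})"
    and "AE s in lebesgue. 0 \<le> s \<longrightarrow> (y has_vector_derivative f s (y s) (v s)) (at s within {0..})"
    using x y by (auto simp: is_solution_def)
  then show "AE s in lebesgue. 0 \<le> s \<longrightarrow>
      (?z has_vector_derivative f s (?z s) (?w s)) (at s within {0..})"
    using AE_lebesgue_neq[of T]
  proof eventually_elim
    case (elim s)
    show ?case
    proof
      assume "0 \<le> s"
      consider "s < T" | "T < s" using elim(3) by linarith
      then show "(?z has_vector_derivative f s (?z s) (?w s)) (at s within {0..})"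
      proof cases
        case 1
        then have "(x has_vector_derivative f s (?z s) (?w s)) (at s within {0..})"
          using elim(1) \<open>0 \<le> s\<close> by (simp add: concat_control_def)
        then show ?thesis
          by (rule has_vector_derivative_transform_within[where d = "T - s"])
            (use 1 \<open>0 \<le> s\<close> in \<open>auto simp: dist_real_def\<close>)
      next
        case 2
        then have "(y has_vector_derivative f s (?z s) (?w s)) (at s within {0..})"
          using elim(2) \<open>0 \<le> s\<close> by (simp add: concat_control_def)
        then show ?thesis
          by (rule has_vector_derivative_transform_within[where d = "s - T"])
            (use 2 \<open>0 \<le> s\<close> in \<open>auto simp: dist_real_def\<close>)
      qed
    qed
  qed
qed

lemma traj_is_solution:
  assumes "well_posed f" "0 \<le> t" "u \<in> controls"
  shows "is_solution f b t u (traj f b t u)"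
  unfolding traj_def
  by (rule theI'[of "is_solution f b t u"]) (use assms in \<open>simp add: well_posed_def\<close>)

lemma traj_initial:
  assumes "well_posed f" "0 \<le> t" "u \<in> controls"
  shows "traj f b t u t = b"
  using traj_is_solution[OF assms] by (simp add: is_solution_def)

lemma traj_unique:
  assumes "well_posed f" "0 \<le> t" "u \<in> controls" "is_solution f b t u x"
  shows "traj f b t u = x"
  unfolding traj_def
  by (rule the1_equality) (use assms in \<open>simp_all add: well_posed_def\<close>)

lemma traj_concat:
  assumes "well_posed f" "0 \<le> t" "t \<le> \<tau>" "u \<in> controls" "v \<in> controls"
    and "concat_control \<tau> u v \<in> controls"
  shows "traj f b t (concat_control \<tau> u v) =
    (\<lambda>s. if s \<le> \<tau> then traj f b t u s else traj f (traj f b t u \<tau>) \<tau> v s)"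
proof (rule traj_unique[OF assms(1,2,6)])
  have \<tau>: "0 \<le> \<tau>" using assms(2,3) by simp
  show "is_solution f b t (concat_control \<tau> u v)
      (\<lambda>s. if s \<le> \<tau> then traj f b t u s else traj f (traj f b t u \<tau>) \<tau> v s)"
    by (rule is_solution_concat[OF traj_is_solution[OF assms(1,2,4)]
          traj_is_solution[OF assms(1) \<tau> assms(5)] \<tau> assms(3)])
qed

section \<open>Splitting the cost\<close>

text \<open>
  At time \<open>\<tau>\<close> the concatenation takes the value of \<open>v\<close>, not of \<open>u\<close>; a single time does not affect the
  integral, but the integrands on \<open>{t..\<tau>}\<close> agree only almost everywhere.
\<close>

lemma cost_concat:
  assumes wp: "well_posed f" and cd: "cost_defined f f0"
    and t: "0 \<le> t" "t \<le> \<tau>"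
    and u: "u \<in> controls" and v: "v \<in> controls" and w: "concat_control \<tau> u v \<in> controls"
  shows "cost f f0 t b (concat_control \<tau> u v) \<tau> = cost f f0 t b u \<tau>"
    and "\<tau> \<le> T \<Longrightarrow> cost f f0 t b (concat_control \<tau> u v) T =
           cost f f0 t b u \<tau> + cost f f0 \<tau> (traj f b t u \<tau>) v T"
proof -
  let ?w = "concat_control \<tau> u v"
  let ?c = "traj f b t u \<tau>"
  let ?F = "\<lambda>b t u s. f0 s (traj f b t u s) (u s)"
  note tr = traj_concat[OF wp t u v w, of b]
  have ws: "s < \<tau> \<Longrightarrow> ?w s = u s" "\<tau> \<le> s \<Longrightarrow> ?w s = v s" for s
    by (simp_all add: concat_control_def)
  have cv: "traj f ?c \<tau> v \<tau> = ?c"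
    using wp v t by (intro traj_initial) auto
  have int: "set_integrable lebesgue {t..T} (?F b t ?w)" if "t \<le> T" for T
    using cd t w that unfolding cost_defined_def by blast
  have intu: "set_integrable lebesgue {t..\<tau>} (?F b t u)"
    using cd t u unfolding cost_defined_def by blast
  have ae: "AE s in lebesgue. indicator {t..\<tau>} s *\<^sub>R ?F b t ?w s = indicator {t..\<tau>} s *\<^sub>R ?F b t u s"
    using AE_lebesgue_neq[of \<tau>]
    by eventually_elim (auto simp: indicator_def ws tr)
  show first: "cost f f0 t b ?w \<tau> = cost f f0 t b u \<tau>"
    unfolding cost_def set_lebesgue_integral_def
    using int[OF t(2)] intu ae
    by (intro integral_cong_AE) (auto simp: set_integrable_def)
  assume T: "\<tau> \<le> T"
  have "cost f f0 t b ?w T = (LINT s:{t..\<tau>} \<union> {\<tau>..T}|lebesgue. ?F b t ?w s)"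
    using t T by (simp add: cost_def ivl_disj_un_two_touch)
  also have "\<dots> = (LINT s:{t..\<tau>}|lebesgue. ?F b t ?w s) + (LINT s:{\<tau>..T}|lebesgue. ?F b t ?w s)"
  proof (rule set_integral_Un_AE)
    show "AE s in lebesgue. \<not> (s \<in> {t..\<tau>} \<and> s \<in> {\<tau>..T})"
      using AE_lebesgue_neq[of \<tau>] by eventually_elim auto
    show "set_integrable lebesgue {\<tau>..T} (?F b t ?w)"
      using int[of T] t T by (auto intro: set_integrable_subset)
  qed (use int t in auto)
  also have "(LINT s:{t..\<tau>}|lebesgue. ?F b t ?w s) = cost f f0 t b u \<tau>"
    using first by (simp add: cost_def)
  also have "(LINT s:{\<tau>..T}|lebesgue. ?F b t ?w s) = cost f f0 \<tau> ?c v T"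
    unfolding cost_def set_lebesgue_integral_def
    by (intro Bochner_Integration.integral_cong)
      (auto simp: tr cv ws indicator_def)
  finally show "cost f f0 t b ?w T = cost f f0 t b u \<tau> + cost f f0 \<tau> ?c v T" .
qed

lemma Liminf_cost_concat:
  assumes "well_posed f" "cost_defined f f0" "0 \<le> t" "t \<le> \<tau>"
    and "u \<in> controls" "v \<in> controls" "concat_control \<tau> u v \<in> controls"
  shows "Liminf at_top (\<lambda>T. ereal (cost f f0 t b (concat_control \<tau> u v) T)) =
    ereal (cost f f0 t b u \<tau>) + Liminf at_top (\<lambda>T. ereal (cost f f0 \<tau> (traj f b t u \<tau>) v T))"
proof -
  have "Liminf at_top (\<lambda>T. ereal (cost f f0 t b (concat_control \<tau> u v) T)) =
      Liminf at_top (\<lambda>T. ereal (cost f f0 t b u \<tau>) + ereal (cost f f0 \<tau> (traj f b t u \<tau>) v T))"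
    by (intro Liminf_eq eventually_mono[OF eventually_ge_at_top[of \<tau>]])
      (simp add: cost_concat(2)[OF assms])
  then show ?thesis by (simp add: Liminf_add_ereal_left del: plus_ereal.simps)
qed

section \<open>Dynamic programming\<close>

text \<open>The infimum over the empty set is the top element, so the case distinction disappears.\<close>

lemma value_fun_eq_INF:
  "value_fun f f0 \<Omega> t b = (INF u\<in>\<Omega> b t. Liminf at_top (\<lambda>T. ereal (cost f f0 t b u T)))"
  by (simp add: value_fun_def top_ereal_def)

lemma INF_ereal_real_add:
  fixes g :: "'i \<Rightarrow> ereal"
  shows "(INF i\<in>I. ereal c + g i) = ereal c + (INF i\<in>I. g i)"
proof (cases "I = {}")
  case False
  then show ?thesis
    using INF_ereal_minus_right[of I "ereal c" "\<lambda>i. - g i"]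
    by (simp add: ereal_SUP_uminus_eq minus_ereal_def)
qed (simp add: top_ereal_def)

lemma cost_trivial_interval: "cost f f0 t b u t = 0"
proof -
  have "AE s in lebesgue. indicator {t..t} s *\<^sub>R f0 s (traj f b t u s) (u s) = 0"
    using AE_lebesgue_neq[of t] by eventually_elim simp
  then show ?thesis
    unfolding cost_def set_lebesgue_integral_def by (rule integral_eq_zero_AE)
qed

lemma controls_nonempty: "controls \<noteq> {}"
proof -
  \<comment> \<open>Controls take the default value at negative times; this is the constant that does so already.\<close>
  have "(\<lambda>_. undefined) \<in> controls"
    by (simp add: controls_def extensional_def image_constant_conv)
  then show ?thesis by blast
qed

lemma value_fun_DPP:
  fixes f :: "real \<Rightarrow> 'x::real_normed_vector \<Rightarrow> 'p::polish_space \<Rightarrow> 'x"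
  assumes wp: "well_posed f" and cd: "cost_defined f f0"
    and ctl: "\<And>b t. 0 \<le> t \<Longrightarrow> \<Omega> b t \<subseteq> controls"
    and ind: "induces_asymptotic_constraints f \<Omega>"
  shows "enjoys_DPP f f0 (value_fun f f0 \<Omega>)"
  unfolding enjoys_DPP_def cost_def[symmetric]
proof (intro allI impI, elim conjE)
  fix b t \<tau> assume t: "0 \<le> t" "t \<le> (\<tau>::real)"
  let ?V = "value_fun f f0 \<Omega>"
  let ?L = "\<lambda>t b u. Liminf at_top (\<lambda>T. ereal (cost f f0 t b u T))"
  let ?c = "\<lambda>u. traj f b t u \<tau>"
  show "?V t b = (INF u\<in>controls. ereal (cost f f0 t b u \<tau>) + ?V \<tau> (?c u))"
  proof (cases "t = \<tau>")
    case True
    \<comment> \<open>The concatenation property speaks only of \<open>\<tau> > t\<close>. Here all terms of the infimum equal the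
      left-hand side, and there is at least one.\<close>
    have "(INF u\<in>controls. ereal (cost f f0 t b u \<tau>) + ?V \<tau> (?c u)) =
        (INF u\<in>(controls :: (real \<Rightarrow> 'p) set). ?V t b)"
      using t True wp by (intro INF_cong refl) (simp add: cost_trivial_interval traj_initial)
    also have "\<dots> = ?V t b"
      by (rule INF_const[OF controls_nonempty])
    finally show ?thesis by simp
  next
    case False
    then have "\<tau> > t" using t by simp
    then have "\<Omega> b t = {concat_control \<tau> u v | u v. u \<in> controls \<and> v \<in> \<Omega> (?c u) \<tau>}"
      using ind t(1) unfolding induces_asymptotic_constraints_def by simp
    then have \<Omega>: "\<Omega> b t = (\<Union>u\<in>controls. concat_control \<tau> u ` \<Omega> (?c u) \<tau>)"
      by auto
    have "?V t b = (INF u\<in>controls. INF v\<in>\<Omega> (?c u) \<tau>. ?L t b (concat_control \<tau> u v))"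
      unfolding value_fun_eq_INF \<Omega>
      by (rule antisym) (auto intro!: INF_greatest intro: INF_lower2)
    also have "\<dots> = (INF u\<in>controls. INF v\<in>\<Omega> (?c u) \<tau>.
        ereal (cost f f0 t b u \<tau>) + ?L \<tau> (?c u) v)"
    proof (intro INF_cong refl Liminf_cost_concat wp cd t)
      fix u v assume "u \<in> controls" "v \<in> \<Omega> (?c u) \<tau>"
      then show "v \<in> controls" "concat_control \<tau> u v \<in> controls"
        using ctl[of \<tau> "?c u"] ctl[of t b] t \<Omega> by auto
    qed
    also have "\<dots> = (INF u\<in>controls. ereal (cost f f0 t b u \<tau>) + ?V \<tau> (?c u))"
      by (simp only: INF_ereal_real_add value_fun_eq_INF)
    finally show ?thesis .
  qed
qed

text \<open>
  A minimizer \<open>w\<close> ends in an admissible control for the state it has reached at time \<open>T\<close>, and the cost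
  of that tail bounds the value there from above. The reverse bound is the dynamic programming
  principle, whose infimum \<open>w\<close> need not attain.
\<close>

lemma optimal_in_view_value_fun:
  assumes wp: "well_posed f" and cd: "cost_defined f f0"
    and ctl: "\<And>b t. 0 \<le> t \<Longrightarrow> \<Omega> b t \<subseteq> controls"
    and ind: "induces_asymptotic_constraints f \<Omega>"
    and w: "w \<in> \<Omega> b 0"
    and opt: "Liminf at_top (\<lambda>T. ereal (cost f f0 0 b w T)) = value_fun f f0 \<Omega> 0 b"
  shows "optimal_in_view f f0 (value_fun f f0 \<Omega>) b w"
proof -
  let ?V = "value_fun f f0 \<Omega>"
  have wc: "w \<in> controls" using ctl[of 0 b] w by auto
  have b: "traj f b 0 w 0 = b" using wp wc by (simp add: traj_initial)
  have "ereal (cost f f0 0 b w T) + ?V T (traj f b 0 w T) = ?V 0 b" if "0 \<le> T" for T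
  proof (cases "T = 0")
    case True
    then show ?thesis by (simp add: cost_trivial_interval b)
  next
    case False
    then have "T > 0" using that by simp
    then obtain u v where uv: "w = concat_control T u v" "u \<in> controls" "v \<in> \<Omega> (traj f b 0 u T) T"
      using ind w unfolding induces_asymptotic_constraints_def by fastforce
    have vc: "v \<in> controls" using uv(3) ctl that by blast
    note prems = wp cd order_refl that uv(2) vc wc[unfolded uv(1)]
    have reach: "traj f b 0 w T = traj f b 0 u T"
      unfolding uv(1) using traj_concat[OF wp order_refl that uv(2) vc wc[unfolded uv(1)]] by simp
    show ?thesis
    proof (rule antisym)
      have "?V T (traj f b 0 u T) \<le>
          Liminf at_top (\<lambda>S. ereal (cost f f0 T (traj f b 0 u T) v S))"
        unfolding value_fun_eq_INF by (rule INF_lower) (rule uv(3))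
      then have "ereal (cost f f0 0 b u T) + ?V T (traj f b 0 u T) \<le>
          Liminf at_top (\<lambda>S. ereal (cost f f0 0 b w S))"
        unfolding uv(1) Liminf_cost_concat[OF prems] by (intro add_left_mono)
      then show "ereal (cost f f0 0 b w T) + ?V T (traj f b 0 w T) \<le> ?V 0 b"
        unfolding reach opt[symmetric] by (simp add: uv(1) cost_concat(1)[OF prems])
      have "?V 0 b = (INF u\<in>controls. ereal (cost f f0 0 b u T) + ?V T (traj f b 0 u T))"
        using value_fun_DPP[OF wp cd ctl ind] that
        unfolding enjoys_DPP_def cost_def by blast
      then show "?V 0 b \<le> ereal (cost f f0 0 b w T) + ?V T (traj f b 0 w T)"
        by (simp only:) (rule INF_lower[OF wc])
    qed
  qed
  then show ?thesis
    by (simp add: optimal_in_view_def Let_def b add.commute)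
qed

theorem theorem4p2:
  fixes f :: "real \<Rightarrow> real ^ 'm \<Rightarrow> 'p::polish_space \<Rightarrow> real ^ 'm"
    and f0 :: "real \<Rightarrow> real ^ 'm \<Rightarrow> 'p \<Rightarrow> real"
    and b_star :: "real ^ 'm"
    and \<Omega> :: "real ^ 'm \<Rightarrow> real \<Rightarrow> (real \<Rightarrow> 'p) set"
  assumes f_continuous: "continuous_on ({0..} \<times> UNIV \<times> UNIV) (\<lambda>(t, x, p). f t x p)"
    and f0_continuous: "continuous_on ({0..} \<times> UNIV \<times> UNIV) (\<lambda>(t, x, p). f0 t x p)"
    and f_lipschitz: "local_lipschitz ({0..} \<times> UNIV) UNIV (\<lambda>(t, p) x. f t x p)"
    and f0_lipschitz: "local_lipschitz ({0..} \<times> UNIV) UNIV (\<lambda>(t, p) x. f0 t x p)"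
    and f_growth: "sublinear_growth f"
    and f_well_posed: "well_posed f"
    and f0_cost_defined: "cost_defined f f0"
    and \<Omega>_controls: "\<And>b t. 0 \<le> t \<Longrightarrow> \<Omega> b t \<subseteq> controls"
    and \<Omega>_induces: "induces_asymptotic_constraints f \<Omega>"
    and V_finite: "\<And>t b. 0 \<le> t \<Longrightarrow> \<bar>value_fun f f0 \<Omega> t b\<bar> \<noteq> \<infinity>"
  shows "enjoys_DPP f f0 (value_fun f f0 \<Omega>) \<and>
    (\<forall>u_star \<in> controls.
       u_star \<in> \<Omega> b_star 0 \<and>
       Liminf at_top (\<lambda>T. ereal (cost f f0 0 b_star u_star T)) = value_fun f f0 \<Omega> 0 b_star
       \<longrightarrow> optimal_in_view f f0 (value_fun f f0 \<Omega>) b_star u_star)"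
  using value_fun_DPP[OF f_well_posed f0_cost_defined \<Omega>_controls \<Omega>_induces]
    optimal_in_view_value_fun[OF f_well_posed f0_cost_defined \<Omega>_controls \<Omega>_induces]
  by blast

end
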